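(* Let $\mu$ be a non-trivial probability measure on $\partial\mathbb{D}$ with Verblunsky coefficients $\{\alpha_n\}$ and reversed polynomials $\Phi_n^*$, and let $\Omega_n(\mu)=\Phi_{n+1}^*/\Phi_n^*$. Let $\{j_n\}$ be an increasing sequence of integers and let $k'\in\mathbb{Z}\cup\{\infty\}$. Then $\Omega_{k+j_n}(\mu)$ converges, for every integer $k<k'$, uniformly on compact subsets of $\mathbb{D}$ as $n\to\infty$ if and only if for each $\ell\ge1$ and each integer $k<k'$ there is $c_{k,\ell}\in\overline{\mathbb{D}}$ such that $$\lim_{n\to\infty}\alpha_{k+j_n}\bar\alpha_{k+j_n-\ell}=c_{k,\ell}.$$
   Context: $\mathbb{D}=\{|z|<1\}$. A probability measure on $\partial\mathbb{D}$ is non-trivial if its support is infinite. $\Phi_n$ ($n\ge0$) are the monic orthogonal polynomials of $\mu$, $\Phi_n^*(z)=z^n\overline{\Phi_n(1/\bar z)}$ the reversed polynomials (which have no zeros in $\mathbb{D}$), and the Verblunsky coefficients $\alpha_n\in\mathbb{D}$ ($n\ge0$) are defined by $\Phi_{n+1}(z)=z\Phi_n(z)-\bar\alpha_n\Phi_n^*(z)$. By convention $\Phi_n^*\equiv1$ for $n\le-1$, $\alpha_{-1}=-1$ and $\alpha_n=0$ for $n\le-2$. "Increasing" means strictly increasing. *)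

theory Defs
  imports "HOL-Probability.Probability"
    "HOL-Computational_Algebra.Polynomial" "HOL-Library.Extended"
begin

definition measure_support :: "'a::topological_space measure \<Rightarrow> 'a set" where
  "measure_support M =
     {z \<in> space M. \<forall>U. open U \<longrightarrow> z \<in> U \<longrightarrow> emeasure M (U \<inter> space M) > 0}"

text \<open>Probability measures on the unit circle live on the subspace
  \<open>sphere 0 1\<close> of the complex plane with its Borel sets.\<close>

definition nontrivial_circle_prob :: "complex measure \<Rightarrow> bool" where
  "nontrivial_circle_prob M \<longleftrightarrow>
     prob_space M \<and> sets M = sets (restrict_space borel (sphere 0 1)) \<and>
     infinite (measure_support M)"

definition monic_orthogonal_sequence :: "complex measure \<Rightarrow> (nat \<Rightarrow> complex poly) \<Rightarrow> bool" where
  "monic_orthogonal_sequence M P \<longleftrightarrow>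
     (\<forall>n. degree (P n) = n \<and> lead_coeff (P n) = 1) \<and>
     (\<forall>m n. m \<noteq> n \<longrightarrow> (LINT z|M. cnj (poly (P m) z) * poly (P n) z) = 0)"

text \<open>Such a sequence exists and is unique for non-trivial \<open>M\<close> (Gram-Schmidt);
  for other measures the value below is irrelevant.\<close>

definition monic_OPUC :: "complex measure \<Rightarrow> nat \<Rightarrow> complex poly" where
  "monic_OPUC M = (THE P. monic_orthogonal_sequence M P)"

text \<open>Reversal of \<open>p\<close> relative to its own degree, which is \<open>n\<close> for \<open>p = monic_OPUC M n\<close>.\<close>

definition reversed_poly :: "complex poly \<Rightarrow> complex poly" where
  "reversed_poly p = reflect_poly (map_poly cnj p)"

lemma poly_reversed_poly:
  assumes "z \<noteq> 0"
  shows "poly (reversed_poly p) z = z ^ degree p * cnj (poly p (1 / cnj z))"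
proof -
  have "degree (map_poly cnj p) = degree p"
    by (rule degree_map_poly) auto
  then show ?thesis
    using assms by (simp add: reversed_poly_def poly_reflect_poly_nz inverse_eq_divide)
qed

definition OPUC_rev :: "complex measure \<Rightarrow> int \<Rightarrow> complex poly" where
  "OPUC_rev M n = (if n \<le> -1 then 1 else reversed_poly (monic_OPUC M (nat n)))"

text \<open>For \<open>n \<ge> 0\<close> the coefficient is the unique number satisfying the Szego recursion.\<close>

definition verblunsky :: "complex measure \<Rightarrow> int \<Rightarrow> complex" where
  "verblunsky M n =
     (if n \<le> -2 then 0
      else if n = -1 then -1
      else (THE a. \<forall>z. poly (monic_OPUC M (Suc (nat n))) z =
              z * poly (monic_OPUC M (nat n)) z - cnj a * poly (OPUC_rev M n) z))"

definition OPUC_ratio :: "complex measure \<Rightarrow> int \<Rightarrow> complex \<Rightarrow> complex" where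
  "OPUC_ratio M n z = poly (OPUC_rev M (n + 1)) z / poly (OPUC_rev M n) z"

end

theory Submission
  imports Defs "HOL-Complex_Analysis.Complex_Analysis"
begin

text \<open>
  Write \<open>\<Phi>\<^sub>n\<close> for the monic orthogonal polynomials, \<open>\<Phi>\<^sub>n\<^sup>*\<close> for their reversals and
  \<open>b\<^sub>n = \<Phi>\<^sub>n / \<Phi>\<^sub>n\<^sup>*\<close>. The Szego recursion gives \<open>\<Omega>\<^sub>n(z) = 1 - \<alpha>\<^sub>n z b\<^sub>n(z)\<close> and
  \<open>b\<^sub>n\<^sub>+\<^sub>1(z) (1 - \<alpha>\<^sub>n z b\<^sub>n(z)) = z b\<^sub>n(z) - cnj \<alpha>\<^sub>n\<close>; since \<open>\<bar>\<alpha>\<^sub>n\<bar> \<le> 1\<close>, an induction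
  shows that \<open>b\<^sub>n\<close> is holomorphic and bounded by 1 on the unit disc
  (\<open>OPUC_rev_nonzero_dominates\<close>), whence \<open>\<bar>\<Omega>\<^sub>n\<bar> \<le> 2\<close> there.

  For uniformly bounded holomorphic functions, locally uniform convergence on the disc is the same
  as convergence of every Taylor coefficient at 0 (\<open>locally_uniform_limit_iff_taylor_coeffs\<close>).
  So the left-hand side says that \<open>\<alpha>\<^sub>N [z\<^sup>m] b\<^sub>N\<close> with \<open>N = k + j\<^sub>n\<close> converges for all \<open>m\<close> and
  all \<open>k < k'\<close>.

  Let \<open>\<gamma>(m, l, k) = \<alpha>\<^sub>N [z\<^sup>m] b\<^sub>N\<^sub>-\<^sub>l\<close>. Comparing coefficients in the recursion for \<open>b\<close> gives, for
  all large \<open>n\<close>,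
  \<open>\<gamma>(0, l, k) = - \<alpha>\<^sub>N cnj \<alpha>\<^sub>N\<^sub>-\<^sub>l\<^sub>-\<^sub>1\<close> and
  \<open>\<gamma>(m + 1, l, k) = \<gamma>(m, l + 1, k) + (\<Sum>i\<le>m. \<gamma>(i, l, k) \<gamma>(m - i, 0, k - l - 1))\<close>.
  The left-hand side is the convergence of all \<open>\<gamma>(m, 0, k)\<close>, the right-hand side that of all
  \<open>\<gamma>(0, l, k)\<close>. Read as a formula for \<open>\<gamma>(m, l + 1, k)\<close>, the identity carries convergence from
  \<open>l = 0\<close> to all \<open>l\<close>; read as a formula for \<open>\<gamma>(m + 1, l, k)\<close>, it carries convergence from
  \<open>m = 0\<close> to all \<open>m\<close> (\<open>convergent_schur_coeffs_iff\<close>). Apart from \<open>k\<close> itself only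
  smaller shifts occur, which is why the condition \<open>k < k'\<close> is harmless.

  Existence of the orthogonal polynomials, the recursion and \<open>\<bar>\<alpha>\<^sub>n\<bar> \<le> 1\<close> are obtained together:
  a sequence defined by the Szego recursion, with the parameter chosen to make the next polynomial
  orthogonal to 1, is monic orthogonal, and the monic orthogonal sequence is unique.
\<close>

section \<open>The inner product on polynomials\<close>

lemma coeff_reversed_poly:
  "coeff (reversed_poly p) k = (if k \<le> degree p then cnj (coeff p (degree p - k)) else 0)"
proof -
  have "degree (map_poly cnj p) = degree p"
    by (rule degree_map_poly) auto
  then show ?thesis
    by (simp add: reversed_poly_def coeff_reflect_poly coeff_map_poly)
qed

lemma poly_reversed_poly_circle:
  assumes "cmod z = 1"
  shows "poly (reversed_poly p) z = z ^ degree p * cnj (poly p z)"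
proof -
  have "z * cnj z = 1"
    using assms by (simp add: complex_norm_square[symmetric])
  then have "1 / cnj z = z"
    by (metis mult_zero_right nonzero_eq_divide_eq zero_neq_one)
  moreover have "z \<noteq> 0" using assms by auto
  ultimately show ?thesis
    by (simp add: poly_reversed_poly)
qed

text \<open>The inner product of \<open>L\<^sup>2(M)\<close> on polynomials, conjugate-linear in the first argument.\<close>
definition circle_inner :: "complex measure \<Rightarrow> complex poly \<Rightarrow> complex poly \<Rightarrow> complex" where
  "circle_inner M p q = (LINT z|M. cnj (poly p z) * poly q z)"

text \<open>A probability measure on the unit circle with infinite support.\<close>
locale nontrivial_circle_measure =
  fixes M :: "complex measure"
  assumes nontrivial: "nontrivial_circle_prob M"
begin

sublocale prob_space M
  using nontrivial by (simp add: nontrivial_circle_prob_def)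

abbreviation "ip \<equiv> circle_inner M"

lemma sets_M: "sets M = sets (restrict_space borel (sphere 0 1))"
  using nontrivial by (simp add: nontrivial_circle_prob_def)

lemma space_M: "space M = sphere 0 1"
  using sets_eq_imp_space_eq[OF sets_M] by (simp add: space_restrict_space)

lemma integrable_continuous_on_circle:
  fixes f :: "complex \<Rightarrow> 'b::{banach, second_countable_topology}"
  assumes "continuous_on (sphere 0 1) f"
  shows "integrable M f"
proof -
  have "f \<in> borel_measurable (restrict_space borel (sphere 0 1))"
    using assms by (rule borel_measurable_continuous_on_restrict)
  then have "f \<in> borel_measurable M"
    using measurable_cong_sets[OF sets_M refl] by blast
  moreover have "bounded (f ` sphere 0 1)"
    using assms by (intro compact_imp_bounded compact_continuous_image) auto
  then obtain B where "\<forall>z\<in>sphere 0 1. norm (f z) \<le> B"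
    unfolding bounded_iff by auto
  ultimately show ?thesis
    by (intro integrable_const_bound[of _ B]) (auto simp: space_M intro!: AE_I2)
qed

lemma integrable_poly_inner: "integrable M (\<lambda>z. cnj (poly p z) * poly q z)"
  by (rule integrable_continuous_on_circle) (intro continuous_intros)

lemma inner_add_right: "ip p (q + r) = ip p q + ip p r"
  by (simp add: circle_inner_def distrib_left integrable_poly_inner)

lemma inner_diff_right: "ip p (q - r) = ip p q - ip p r"
  by (simp add: circle_inner_def right_diff_distrib integrable_poly_inner)

lemma inner_diff_left: "ip (p - q) r = ip p r - ip q r"
  by (simp add: circle_inner_def left_diff_distrib integrable_poly_inner)

lemma inner_add_left: "ip (p + q) r = ip p r + ip q r"
  by (simp add: circle_inner_def distrib_right integrable_poly_inner)

lemma inner_smult_right: "ip p (smult c q) = c * ip p q"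
  by (simp add: circle_inner_def mult.left_commute)

lemma inner_smult_left: "ip (smult c p) q = cnj c * ip p q"
  by (simp add: circle_inner_def mult.assoc)

lemma inner_0_left [simp]: "ip 0 p = 0"
  by (simp add: circle_inner_def)

lemma inner_commute: "ip q p = cnj (ip p q)"
proof -
  have "ip q p = (LINT z|M. cnj (cnj (poly p z) * poly q z))"
    unfolding circle_inner_def
    by (rule Bochner_Integration.integral_cong) (simp_all add: mult.commute)
  then show ?thesis
    by (simp only: Bochner_Integration.integral_cnj circle_inner_def)
qed

lemma inner_cong_circle:
  assumes "\<And>z. cmod z = 1 \<Longrightarrow> cnj (poly p z) * poly q z = cnj (poly r z) * poly s z"
  shows "ip p q = ip r s"
  unfolding circle_inner_def
  by (rule Bochner_Integration.integral_cong) (auto simp: space_M assms)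

text \<open>Multiplication by \<open>z\<close> is an isometry, because \<open>z * cnj z = 1\<close> on the circle.\<close>
lemma inner_shift: "ip (pCons 0 p) (pCons 0 q) = ip p q"
proof (rule inner_cong_circle)
  fix z :: complex assume "cmod z = 1"
  then have "cnj z * z = 1" by (simp add: complex_norm_square[symmetric] mult.commute)
  then show "cnj (poly (pCons 0 p) z) * poly (pCons 0 q) z = cnj (poly p z) * poly q z"
    by (simp add: algebra_simps)
qed

lemma inner_self: "ip p p = of_real (LINT z|M. (cmod (poly p z))\<^sup>2)"
  unfolding circle_inner_def integral_complex_of_real [symmetric]
  by (intro Bochner_Integration.integral_cong) (auto simp: complex_norm_square mult.commute simp del: of_real_power)

text \<open>The inner product is definite: if \<open>p\<close> vanishes almost everywhere, the support of \<open>M\<close> lies in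
  the zero set of \<open>p\<close>, which is finite for \<open>p \<noteq> 0\<close>.\<close>
lemma inner_self_pos:
  assumes "p \<noteq> 0"
  obtains r where "r > 0" "ip p p = complex_of_real r"
proof -
  let ?f = "\<lambda>z. (cmod (poly p z))\<^sup>2"
  have int: "integrable M ?f"
    by (rule integrable_continuous_on_circle) (intro continuous_intros)
  have "(LINT z|M. ?f z) \<noteq> 0"
  proof
    assume "(LINT z|M. ?f z) = 0"
    then have ae: "AE z in M. poly p z = 0"
      using integral_nonneg_eq_0_iff_AE[OF int] by simp
    have "measure_support M \<subseteq> {z. poly p z = 0}"
    proof (rule ccontr)
      assume "\<not> ?thesis"
      then obtain z where z: "z \<in> measure_support M" "poly p z \<noteq> 0" by auto
      let ?U = "{w. poly p w \<noteq> 0}"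
      have "open ?U"
        by (intro open_Collect_neq continuous_intros)
      then have "emeasure M (?U \<inter> space M) > 0"
        using z unfolding measure_support_def by blast
      moreover have "?U \<inter> space M \<in> sets M"
        unfolding sets_M space_M sets_restrict_space Int_commute[of ?U]
        using borel_open[OF \<open>open ?U\<close>] by (rule imageI)
      then have "emeasure M (?U \<inter> space M) = 0"
        using ae AE_iff_measurable[of "?U \<inter> space M" M "\<lambda>z. poly p z = 0"] by blast
      ultimately show False
        by simp
    qed
    then have "finite (measure_support M)"
      using poly_roots_finite[OF assms] by (rule finite_subset)
    then show False
      using nontrivial by (simp add: nontrivial_circle_prob_def)
  qed
  moreover have "(LINT z|M. ?f z) \<ge> 0"
    by simp
  ultimately have "(LINT z|M. ?f z) > 0"
    by linarith
  then show thesis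
    using inner_self by (rule that)
qed

lemma inner_self_eq_0_iff: "ip p p = 0 \<longleftrightarrow> p = 0"
proof
  assume "ip p p = 0"
  show "p = 0"
  proof (rule ccontr)
    assume "p \<noteq> 0"
    then obtain r where "r > 0" "ip p p = complex_of_real r"
      by (rule inner_self_pos)
    with \<open>ip p p = 0\<close> show False by simp
  qed
qed simp

text \<open>A polynomial orthogonal to a monic sequence up to degree \<open>n - 1\<close> is orthogonal to every
  polynomial of degree less than \<open>n\<close>. The degree condition on \<open>q\<close> is stated through coefficients
  so that it covers \<open>n = 0\<close>, where it means \<open>q = 0\<close>.\<close>
lemma orthogonal_lower_degree:
  assumes basis: "\<And>i. i < n \<Longrightarrow> degree (P i) = i \<and> lead_coeff (P i) = 1"
    and orth: "\<And>i. i < n \<Longrightarrow> ip (P i) p = 0"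
    and q: "\<And>k. k \<ge> n \<Longrightarrow> coeff q k = 0"
  shows "ip q p = 0"
proof -
  have "m \<le> n \<Longrightarrow> (\<forall>k\<ge>m. coeff q k = 0) \<Longrightarrow> ip q p = 0" for m q
  proof (induction m arbitrary: q)
    case 0
    then have "q = 0" by (simp add: poly_eq_iff)
    then show ?case by simp
  next
    case (Suc m)
    let ?r = "q - smult (coeff q m) (P m)"
    have m: "m < n" using Suc.prems(1) by simp
    have deg: "degree (P m) = m"
      using basis[OF m] by (rule conjunct1)
    have lead: "coeff (P m) m = 1"
      using conjunct2[OF basis[OF m]] by (simp only: deg)
    have "coeff ?r k = 0" if "k \<ge> m" for k
    proof (cases "k = m")
      case True
      then show ?thesis by (simp add: lead)
    next
      case False
      then have "k \<ge> Suc m" using that by simp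
      then have "coeff q k = 0" "coeff (P m) k = 0"
        using Suc.prems(2) by (blast, intro coeff_eq_0) (simp add: deg)
      then show ?thesis by simp
    qed
    then have "\<forall>k\<ge>m. coeff ?r k = 0"
      by blast
    with less_imp_le[OF m] have "ip ?r p = 0"
      by (rule Suc.IH)
    then show ?case
      using orth[of m] Suc.prems(1) by (simp add: inner_diff_left inner_smult_left)
  qed
  from this[OF order_refl] show ?thesis using q by simp
qed

text \<open>On the circle, reversal is \<open>p \<mapsto> z\<^sup>n cnj p\<close> with \<open>n = degree p\<close>, so orthogonality of \<open>p\<close> to
  \<open>1, \<dots>, z\<^sup>n\<^sup>-\<^sup>1\<close> becomes orthogonality of the reversal to \<open>z, \<dots>, z\<^sup>n\<close>.\<close>
lemma inner_monom_reversed: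
  assumes "k \<le> degree p"
  shows "ip (monom 1 k) (reversed_poly p) = cnj (ip (monom 1 (degree p - k)) p)"
proof -
  have "cnj (poly (monom 1 k) z) * poly (reversed_poly p) z
      = cnj (poly p z) * poly (monom 1 (degree p - k)) z" if z: "cmod z = 1" for z
  proof -
    have "cnj z * z = 1"
      using z by (simp add: complex_norm_square[symmetric] mult.commute)
    then have "cnj z ^ k * z ^ degree p = z ^ (degree p - k)"
    proof -
      have "cnj z ^ k * z ^ degree p = cnj z ^ k * z ^ (k + (degree p - k))"
        using assms by simp
      also have "\<dots> = (cnj z * z) ^ k * z ^ (degree p - k)"
        by (simp only: power_add power_mult_distrib mult.assoc)
      finally show ?thesis
        using \<open>cnj z * z = 1\<close> by simp
    qed
    then show ?thesis
      by (simp add: poly_monom poly_reversed_poly_circle[OF z] mult.assoc[symmetric])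
  qed
  then have "ip (monom 1 k) (reversed_poly p) = ip p (monom 1 (degree p - k))"
    by (rule inner_cong_circle)
  also have "\<dots> = cnj (ip (monom 1 (degree p - k)) p)"
    by (rule inner_commute)
  finally show ?thesis .
qed

lemma inner_reversed_self: "ip (reversed_poly p) (reversed_poly p) = ip p p"
proof (rule inner_cong_circle)
  fix z :: complex assume z: "cmod z = 1"
  then have "z * cnj z = 1"
    by (simp add: complex_norm_square[symmetric])
  then have "z ^ degree p * cnj z ^ degree p = 1"
    by (metis power_mult_distrib power_one)
  moreover have "cnj (poly (reversed_poly p) z) * poly (reversed_poly p) z
      = (z ^ degree p * cnj z ^ degree p) * (cnj (poly p z) * poly p z)"
    by (simp add: poly_reversed_poly_circle[OF z] mult_ac)
  ultimately show "cnj (poly (reversed_poly p) z) * poly (reversed_poly p) z = cnj (poly p z) * poly p z"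
    by simp
qed

end

section \<open>Orthogonal polynomials and the Szego recursion\<close>

text \<open>The sequence produced by the Szego recursion; the factor of the reversed polynomial is the one
  that makes the next polynomial orthogonal to 1. It is the conjugate of the Verblunsky
  coefficient.\<close>
primrec szego_poly :: "complex measure \<Rightarrow> nat \<Rightarrow> complex poly" where
  "szego_poly M 0 = 1"
| "szego_poly M (Suc n) = pCons 0 (szego_poly M n) -
     smult (circle_inner M 1 (pCons 0 (szego_poly M n)) /
            circle_inner M (szego_poly M n) (szego_poly M n))
       (reversed_poly (szego_poly M n))"

lemma degree_szego_step:
  assumes "degree p = n" "lead_coeff p = 1"
  shows "degree (pCons 0 p - smult c (reversed_poly p)) = Suc n \<and>
    lead_coeff (pCons 0 p - smult c (reversed_poly p)) = 1"
proof -
  let ?q = "pCons 0 p - smult c (reversed_poly p)"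
  have "coeff ?q k = 0" if "k > Suc n" for k
    using that assms by (auto simp: coeff_pCons coeff_reversed_poly coeff_eq_0 split: nat.split)
  moreover have "coeff ?q (Suc n) = 1"
    using assms by (simp add: coeff_reversed_poly)
  ultimately have "degree ?q = Suc n"
    by (metis degree_le le_degree le_antisym zero_neq_one)
  with \<open>coeff ?q (Suc n) = 1\<close> show ?thesis by simp
qed

lemma reversed_szego_step:
  assumes "degree p = n" "lead_coeff p = 1"
  shows "reversed_poly (pCons 0 p - smult c (reversed_poly p)) =
    reversed_poly p - smult (cnj c) (pCons 0 p)"
proof (rule poly_eqI)
  fix k
  show "coeff (reversed_poly (pCons 0 p - smult c (reversed_poly p))) k =
    coeff (reversed_poly p - smult (cnj c) (pCons 0 p)) k"
  proof (cases k)
    case 0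
    then show ?thesis
      using assms degree_szego_step[OF assms, of c] by (simp add: coeff_reversed_poly)
  next
    case (Suc i)
    show ?thesis
    proof (cases "i \<le> n")
      case True
      then have "n - (n - i) = i" by simp
      moreover have "n - i = Suc (n - Suc i)" if "i \<noteq> n" using that True by simp
      ultimately show ?thesis
        using Suc True assms degree_szego_step[OF assms, of c]
        by (cases "i = n") (simp_all add: coeff_reversed_poly)
    next
      case False
      then show ?thesis
        using Suc assms degree_szego_step[OF assms, of c]
        by (simp add: coeff_reversed_poly coeff_eq_0)
    qed
  qed
qed

context nontrivial_circle_measure
begin

lemma szego_poly_monic: "degree (szego_poly M n) = n \<and> lead_coeff (szego_poly M n) = 1"
proof (induction n)
  case (Suc n)
  then show ?case
    unfolding szego_poly.simps by (intro degree_szego_step) auto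
qed simp

lemma szego_poly_nz [simp]: "szego_poly M n \<noteq> 0"
  using szego_poly_monic[of n] by auto

text \<open>In the step, orthogonality to \<open>z, \<dots>, z\<^sup>n\<close> holds for any choice of the recursion parameter, and
  orthogonality to 1 holds by the choice made, since the reversed polynomial has inner product
  \<open>\<parallel>\<Phi>\<^sub>n\<parallel>\<^sup>2\<close> with 1.\<close>
lemma szego_poly_orthogonal_monom: "k < n \<Longrightarrow> ip (monom 1 k) (szego_poly M n) = 0"
proof (induction n arbitrary: k)
  case (Suc n)
  let ?p = "szego_poly M n"
  have deg: "degree ?p = n" using szego_poly_monic by simp
  have shift: "monom 1 (Suc i) = pCons 0 (monom (1::complex) i)" for i
    by (simp add: monom_Suc)
  show ?case
  proof (cases k)
    case 0
    have "ip ?p ?p = ip (monom 1 n) ?p"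
    proof -
      have "ip (?p - monom 1 n) ?p = 0"
      proof (rule orthogonal_lower_degree[where P = "monom 1" and n = n])
        show "coeff (?p - monom 1 n) k = 0" if "n \<le> k" for k
          using that deg szego_poly_monic[of n] by (cases "k = n") (auto simp: coeff_eq_0)
      qed (use Suc.IH in \<open>auto simp: degree_monom_eq\<close>)
      then show ?thesis by (simp add: inner_diff_left)
    qed
    then have "ip 1 (reversed_poly ?p) = cnj (ip ?p ?p)"
      using inner_monom_reversed[of 0 ?p] deg by simp
    then have "ip 1 (reversed_poly ?p) = ip ?p ?p"
      using inner_commute[of ?p ?p] by (rule trans[OF _ sym])
    moreover have "ip ?p ?p \<noteq> 0"
      by (simp add: inner_self_eq_0_iff)
    ultimately show ?thesis
      using 0 by (simp add: inner_diff_right inner_smult_right)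
  next
    case (Suc i)
    then have i: "i < n" using Suc.prems by simp
    have "ip (monom 1 k) (pCons 0 ?p) = 0"
      using Suc.IH[OF i] by (simp add: \<open>k = Suc i\<close> shift inner_shift)
    moreover have "ip (monom 1 k) (reversed_poly ?p) = 0"
      using Suc.IH[of "n - k"] i \<open>k = Suc i\<close> deg by (simp add: inner_monom_reversed)
    ultimately show ?thesis
      by (simp add: inner_diff_right inner_smult_right)
  qed
qed simp

lemma szego_poly_orthogonal:
  assumes "\<And>k. k \<ge> n \<Longrightarrow> coeff q k = 0"
  shows "ip q (szego_poly M n) = 0"
  by (rule orthogonal_lower_degree[where P = "monom 1" and n = n])
     (use assms szego_poly_orthogonal_monom in \<open>auto simp: degree_monom_eq\<close>)

lemma monic_orthogonal_szego_poly: "monic_orthogonal_sequence M (szego_poly M)"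
proof -
  have less: "ip (szego_poly M m) (szego_poly M n) = 0" if "m < n" for m n
    using that szego_poly_monic[of m] by (intro szego_poly_orthogonal) (auto intro: coeff_eq_0)
  have "ip (szego_poly M m) (szego_poly M n) = 0" if "m \<noteq> n" for m n
    using that less[of m n] less[of n m] inner_commute[of "szego_poly M m" "szego_poly M n"]
    by (cases "m < n") auto
  then show ?thesis
    using szego_poly_monic unfolding monic_orthogonal_sequence_def circle_inner_def by blast
qed

lemma monic_orthogonal_sequence_unique:
  assumes "monic_orthogonal_sequence M P"
  shows "P = szego_poly M"
proof
  fix n
  have monic: "degree (P i) = i" "lead_coeff (P i) = 1" for i
    using assms unfolding monic_orthogonal_sequence_def by blast+
  have orth: "ip (P i) (P n) = 0" if "i < n" for i
    using assms that by (auto simp: monic_orthogonal_sequence_def circle_inner_def)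
  let ?d = "P n - szego_poly M n"
  have d: "coeff ?d k = 0" if "k \<ge> n" for k
    using that monic[of n] szego_poly_monic[of n] by (cases "k = n") (auto simp: coeff_eq_0)
  have "ip ?d (P n) = 0"
    by (rule orthogonal_lower_degree[where P = P and n = n]) (use monic orth d in auto)
  moreover have "ip ?d (szego_poly M n) = 0"
    using d by (rule szego_poly_orthogonal)
  ultimately have "ip ?d ?d = 0"
    by (simp add: inner_diff_right)
  then show "P n = szego_poly M n"
    by (simp add: inner_self_eq_0_iff)
qed

lemma monic_OPUC_eq_szego_poly: "monic_OPUC M = szego_poly M"
  unfolding monic_OPUC_def
  using monic_orthogonal_szego_poly monic_orthogonal_sequence_unique by (rule the_equality)

lemma OPUC_rev_nat: "OPUC_rev M (int n) = reversed_poly (monic_OPUC M n)"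
  by (simp add: OPUC_rev_def)

lemma
  degree_monic_OPUC: "degree (monic_OPUC M n) = n" and
  lead_coeff_monic_OPUC: "lead_coeff (monic_OPUC M n) = 1"
  unfolding monic_OPUC_eq_szego_poly
  by (rule conjunct1[OF szego_poly_monic], rule conjunct2[OF szego_poly_monic])

lemma monic_OPUC_Suc:
  "monic_OPUC M (Suc n) = pCons 0 (monic_OPUC M n) -
     smult (cnj (verblunsky M (int n))) (reversed_poly (monic_OPUC M n))"
proof -
  define c where "c = ip 1 (pCons 0 (szego_poly M n)) / ip (szego_poly M n) (szego_poly M n)"
  let ?rec = "\<lambda>a. \<forall>z. poly (monic_OPUC M (Suc n)) z =
              z * poly (monic_OPUC M n) z - cnj a * poly (OPUC_rev M (int n)) z"
  have step: "monic_OPUC M (Suc n) = pCons 0 (monic_OPUC M n) - smult c (reversed_poly (monic_OPUC M n))"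
    by (simp add: monic_OPUC_eq_szego_poly c_def)
  have rev0: "poly (reversed_poly (monic_OPUC M n)) 0 = 1"
    using lead_coeff_monic_OPUC[of n] by (simp add: poly_0_coeff_0 coeff_reversed_poly)
  have "(THE a. ?rec a) = cnj c"
  proof (rule the_equality)
    show "?rec (cnj c)"
      by (simp add: step OPUC_rev_nat)
  next
    fix a assume "?rec a"
    then have "poly (monic_OPUC M (Suc n)) 0 = - cnj a"
      by (simp add: OPUC_rev_nat rev0)
    then show "a = cnj c"
      by (simp add: step rev0)
  qed
  then have "verblunsky M (int n) = cnj c"
    by (simp add: verblunsky_def)
  then show ?thesis
    using step by simp
qed

lemma OPUC_rev_Suc:
  "OPUC_rev M (int n + 1) = OPUC_rev M (int n) -
     smult (verblunsky M (int n)) (pCons 0 (monic_OPUC M n))"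
proof -
  have "OPUC_rev M (int n + 1) = reversed_poly (monic_OPUC M (Suc n))"
    unfolding OPUC_rev_nat [symmetric] by (rule arg_cong [of _ _ "OPUC_rev M"]) simp
  then show ?thesis
    using reversed_szego_step[OF degree_monic_OPUC lead_coeff_monic_OPUC] by (simp add: monic_OPUC_Suc OPUC_rev_nat)
qed

text \<open>Pythagoras for \<open>z \<Phi>\<^sub>n = \<Phi>\<^sub>n\<^sub>+\<^sub>1 + cnj \<alpha>\<^sub>n \<Phi>\<^sub>n\<^sup>*\<close>: the two summands are orthogonal, and
  \<open>\<Phi>\<^sub>n\<close>, \<open>z \<Phi>\<^sub>n\<close> and \<open>\<Phi>\<^sub>n\<^sup>*\<close> have the same norm.\<close>
lemma norm_verblunsky_nat_le_1: "cmod (verblunsky M (int n)) \<le> 1"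
proof -
  define a where "a = verblunsky M (int n)"
  let ?p = "szego_poly M n" and ?p' = "szego_poly M (Suc n)"
  let ?r = "reversed_poly ?p"
  have zp: "pCons 0 ?p = ?p' + smult (cnj a) ?r"
    using monic_OPUC_Suc[of n] by (simp add: monic_OPUC_eq_szego_poly a_def del: szego_poly.simps)
  have o1: "ip ?r ?p' = 0"
    using szego_poly_monic[of n] by (intro szego_poly_orthogonal) (auto simp: coeff_reversed_poly)
  then have o2: "ip ?p' ?r = 0"
    using inner_commute[of ?r ?p'] by simp
  have "ip ?p ?p = ip (pCons 0 ?p) (pCons 0 ?p)"
    by (simp add: inner_shift)
  also have "\<dots> = ip ?p' ?p' + (a * cnj a) * ip ?p ?p"
    unfolding zp by (simp add: inner_add_left inner_add_right inner_smult_left inner_smult_right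
        o1 o2 inner_reversed_self del: szego_poly.simps)
  finally have eq: "ip ?p ?p = ip ?p' ?p' + of_real ((cmod a)\<^sup>2) * ip ?p ?p"
    by (simp add: complex_norm_square del: szego_poly.simps of_real_power)
  obtain r where r: "r > 0" "ip ?p ?p = complex_of_real r"
    using inner_self_pos szego_poly_nz by blast
  obtain s where s: "s > 0" "ip ?p' ?p' = complex_of_real s"
    using inner_self_pos szego_poly_nz by blast
  have "complex_of_real r = complex_of_real (s + (cmod a)\<^sup>2 * r)"
    using eq r(2) s(2) by simp
  then have "r = s + (cmod a)\<^sup>2 * r"
    using of_real_eq_iff by blast
  then have "(cmod a)\<^sup>2 * r < 1 * r" using s by simp
  then have "(cmod a)\<^sup>2 < 1" using r(1) by (simp only: mult_less_cancel_right)
  then show ?thesis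
    by (simp add: a_def[symmetric] abs_square_less_1[of "cmod a", simplified] less_imp_le)
qed

lemma norm_verblunsky_le_1: "cmod (verblunsky M n) \<le> 1"
proof (cases "n \<ge> 0")
  case True
  then show ?thesis
    using norm_verblunsky_nat_le_1[of "nat n"] by simp
qed (simp add: verblunsky_def)

end

section \<open>Locally uniform convergence and Taylor coefficients\<close>

lemma fps_eq_if_eq_on_disc:
  fixes f g :: "complex \<Rightarrow> complex"
  assumes "f has_fps_expansion F" "g has_fps_expansion G"
    and "\<And>z. norm z < 1 \<Longrightarrow> f z = g z"
  shows "F = G"
proof -
  have "\<forall>\<^sub>F z in nhds 0. z \<in> ball (0::complex) 1"
    by (intro eventually_nhds_in_open) auto
  then have "\<forall>\<^sub>F z in nhds 0. f z = g z"
    by eventually_elim (simp add: assms(3))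
  then have "f has_fps_expansion G"
    using assms(2) has_fps_expansion_cong by blast
  then show ?thesis
    using assms(1) fps_expansion_unique_complex by blast
qed

text \<open>For the converse, Cauchy's estimate bounds the \<open>m\<close>-th coefficients by \<open>B / r\<^sup>m\<close> for every
  \<open>r < 1\<close>, and dominated convergence for series (Tannery's theorem) gives uniform convergence on
  discs of radius \<open>\<rho> < r\<close>.\<close>
lemma locally_uniform_limit_iff_taylor_coeffs:
  fixes f :: "nat \<Rightarrow> complex \<Rightarrow> complex"
  assumes holo: "\<And>n. f n holomorphic_on ball 0 1"
    and bound: "\<And>n z. norm z < 1 \<Longrightarrow> norm (f n z) \<le> B"
  shows "(\<exists>g. \<forall>K. compact K \<and> K \<subseteq> ball 0 1 \<longrightarrow> uniform_limit K f g sequentially) \<longleftrightarrow>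
         (\<forall>m. convergent (\<lambda>n. fps_nth (fps_expansion (f n) 0) m))"
proof
  assume "\<exists>g. \<forall>K. compact K \<and> K \<subseteq> ball 0 1 \<longrightarrow> uniform_limit K f g sequentially"
  then obtain g where g: "\<And>K. compact K \<Longrightarrow> K \<subseteq> ball 0 1 \<Longrightarrow> uniform_limit K f g sequentially"
    by blast
  have "cball (0::complex) (1/2) \<subseteq> ball 0 1"
    by auto
  then have "uniform_limit (cball 0 (1/2)) f g sequentially"
    by (intro g) auto
  then have lim: "uniform_limit (ball 0 (1/2)) f g sequentially"
    by (rule uniform_limit_on_subset) auto
  have "f n holomorphic_on ball 0 (1/2)" for n
    using holo by (rule holomorphic_on_subset) auto
  then have "(\<lambda>n. (deriv ^^ m) (f n) 0) \<longlonglongrightarrow> (deriv ^^ m) g 0" for m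
    using higher_deriv_complex_uniform_limit[OF lim] by simp
  then have "(\<lambda>n. (deriv ^^ m) (f n) 0 / fact m) \<longlonglongrightarrow> (deriv ^^ m) g 0 / fact m" for m
    by (intro tendsto_divide) auto
  then show "\<forall>m. convergent (\<lambda>n. fps_nth (fps_expansion (f n) 0) m)"
    unfolding fps_expansion_def fps_nth_Abs_fps convergent_def by blast
next
  let ?a = "\<lambda>n m. fps_nth (fps_expansion (f n) 0) m"
  assume "\<forall>m. convergent (\<lambda>n. ?a n m)"
  then obtain c where c: "\<And>m. (\<lambda>n. ?a n m) \<longlonglongrightarrow> c m"
    unfolding convergent_def by metis
  have expansion: "(\<lambda>m. ?a n m * z ^ m) sums f n z" if "norm z < 1" for n z
  proof (rule has_fps_expansion_imp_sums_complex)
    show "f n has_fps_expansion fps_expansion (f n) 0"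
      using holo[of n] by (intro has_fps_expansion_fps_expansion[of "ball 0 1"]) auto
    show "f n holomorphic_on eball 0 (ereal 1)"
      using holo[of n] by simp
  qed (use that in simp)
  have coeff_le: "norm (?a n m) \<le> B / r ^ m" if r: "0 < r" "r < 1" for n m r
  proof -
    have sub: "ball 0 r \<subseteq> ball (0::complex) 1" "cball 0 r \<subseteq> ball (0::complex) 1"
      using r by auto
    have "norm ((deriv ^^ m) (f n) 0) \<le> fact m * B / r ^ m"
    proof (rule Cauchy_inequality)
      show "f n holomorphic_on ball 0 r"
        using holo sub(1) by (rule holomorphic_on_subset)
      show "continuous_on (cball 0 r) (f n)"
        using holo sub(2) by (intro holomorphic_on_imp_continuous_on) (rule holomorphic_on_subset)
    qed (use r bound in auto)
    then show ?thesis
      by (simp add: fps_expansion_def norm_divide field_simps)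
  qed
  have climit_le: "norm (c m) \<le> B / r ^ m" if "0 < r" "r < 1" for m r
    by (rule Lim_norm_ubound[OF _ c]) (use coeff_le[OF that] in auto)
  have "uniform_limit K f (\<lambda>z. \<Sum>m. c m * z ^ m) sequentially"
    if K: "compact K" "K \<subseteq> ball 0 1" for K
  proof -
    obtain \<rho> where \<rho>: "0 \<le> \<rho>" "\<rho> < 1" "\<And>z. z \<in> K \<Longrightarrow> norm z \<le> \<rho>"
    proof (cases "K = {}")
      case True
      then show ?thesis using that[of 0] by simp
    next
      case False
      have "continuous_on K (norm :: complex \<Rightarrow> real)" by (intro continuous_intros)
      from continuous_attains_sup[OF K(1) False this]
      obtain w where w: "w \<in> K" "\<forall>z\<in>K. norm z \<le> norm w" by blast
      then show ?thesis using that[of "norm w"] K(2) by auto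
    qed
    \<comment> \<open>Any radius strictly between \<open>\<rho>\<close> and 1 makes the majorant geometric.\<close>
    define r where "r = (1 + \<rho>) / 2"
    have r: "0 < r" "r < 1" "\<rho> < r"
      using \<rho>(1,2) by (auto simp: r_def)
    have majorant: "norm (?a n m - c m) * \<rho> ^ m \<le> 2 * B * (\<rho> / r) ^ m" for n m
    proof -
      have "norm (?a n m - c m) \<le> B / r ^ m + B / r ^ m"
        using coeff_le[OF r(1,2)] climit_le[OF r(1,2)] by (intro norm_triangle_le_diff add_mono)
      then have "norm (?a n m - c m) * \<rho> ^ m \<le> (B / r ^ m + B / r ^ m) * \<rho> ^ m"
        using \<rho>(1) by (intro mult_right_mono) auto
      then show ?thesis
        by (simp add: power_divide field_simps)
    qed
    have geo: "summable (\<lambda>m. 2 * B * (\<rho> / r) ^ m)"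
      using r \<rho>(1) by (intro summable_mult summable_geometric) auto
    have "(\<lambda>n. norm (?a n m - c m) * \<rho> ^ m) \<longlonglongrightarrow> 0 * \<rho> ^ m" for m
      using c[of m] by (intro tendsto_mult tendsto_const tendsto_norm_zero) (simp add: LIM_zero)
    then have term0: "(\<lambda>n. norm (?a n m - c m) * \<rho> ^ m) \<longlonglongrightarrow> 0" for m
      by simp
    have tail: "(\<lambda>n. \<Sum>m. norm (?a n m - c m) * \<rho> ^ m) \<longlonglongrightarrow> 0"
    proof -
      have "((\<lambda>n. \<Sum>m. norm (?a n m - c m) * \<rho> ^ m) \<longlongrightarrow> (\<Sum>m. 0)) sequentially"
      proof (rule conjunct2[OF conjunct2[OF tannerys_theorem[OF term0 _ geo]]])
        show "\<forall>\<^sub>F (m, n) in sequentially \<times>\<^sub>F sequentially.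
          norm (norm (?a n m - c m) * \<rho> ^ m) \<le> 2 * B * (\<rho> / r) ^ m"
          using majorant \<rho>(1) by (intro always_eventually) (auto simp: abs_mult)
      qed simp
      then show ?thesis by simp
    qed
    have summ: "summable (\<lambda>m. norm (?a n m - c m) * \<rho> ^ m)" for n
      by (rule summable_comparison_test[OF _ geo])
         (use majorant \<rho>(1) in \<open>auto simp: abs_mult intro!: exI[of _ 0]\<close>)
    have diff_le: "norm (f n z - (\<Sum>m. c m * z ^ m)) \<le> (\<Sum>m. norm (?a n m - c m) * \<rho> ^ m)"
      if z: "z \<in> K" for n z
    proof -
      have z1: "norm z < 1" using z K(2) by auto
      have le: "norm ((?a n m - c m) * z ^ m) \<le> norm (?a n m - c m) * \<rho> ^ m" for m
        using \<rho>(3)[OF z] by (simp add: norm_mult norm_power mult_left_mono power_mono)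
      have s1: "summable (\<lambda>m. norm ((?a n m - c m) * z ^ m))"
        by (rule summable_comparison_test[OF _ summ[of n]])
           (use le in \<open>auto intro!: exI[of _ 0]\<close>)
      have s2: "summable (\<lambda>m. ?a n m * z ^ m - (?a n m - c m) * z ^ m)"
        using expansion[OF z1, of n] summable_norm_cancel[OF s1]
        by (intro summable_diff) (auto simp: sums_iff)
      then have s3: "summable (\<lambda>m. c m * z ^ m)"
        by (simp add: algebra_simps)
      have "f n z - (\<Sum>m. c m * z ^ m) = (\<Sum>m. ?a n m * z ^ m - c m * z ^ m)"
        using expansion[OF z1, of n] s3 by (subst suminf_diff[symmetric]) (auto simp: sums_iff)
      also have "\<dots> = (\<Sum>m. (?a n m - c m) * z ^ m)"
        by (simp only: left_diff_distrib)
      also have "norm \<dots> \<le> (\<Sum>m. norm ((?a n m - c m) * z ^ m))"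
        using s1 by (rule summable_norm)
      also have "\<dots> \<le> (\<Sum>m. norm (?a n m - c m) * \<rho> ^ m)"
        using le s1 summ by (intro suminf_le) auto
      finally show ?thesis .
    qed
    show ?thesis
    proof (rule uniform_limitI)
      fix e :: real assume "e > 0"
      then have "\<forall>\<^sub>F n in sequentially. (\<Sum>m. norm (?a n m - c m) * \<rho> ^ m) < e"
        using tail by (simp add: order_tendstoD(2))
      then show "\<forall>\<^sub>F n in sequentially. \<forall>z\<in>K. dist (f n z) (\<Sum>m. c m * z ^ m) < e"
        by eventually_elim (use diff_le in \<open>auto simp: dist_norm intro: le_less_trans\<close>)
    qed
  qed
  then show "\<exists>g. \<forall>K. compact K \<and> K \<subseteq> ball 0 1 \<longrightarrow> uniform_limit K f g sequentially"
    by blast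
qed

section \<open>Convergence of coefficients along shifted sequences\<close>

text \<open>Here \<open>\<beta> m p\<close> plays the role of the \<open>m\<close>-th Taylor coefficient of \<open>b\<^sub>p\<close>. The recursion is required
  for \<open>p \<ge> 1\<close> only, because \<open>j\<close> tends to infinity. The set \<open>S\<close> of admissible shifts must be
  closed downwards, as the recursion leads from \<open>k\<close> to smaller shifts.\<close>
lemma convergent_schur_coeffs_iff:
  fixes \<alpha> :: "int \<Rightarrow> complex" and \<beta> :: "nat \<Rightarrow> int \<Rightarrow> complex" and j :: "nat \<Rightarrow> int"
  assumes \<beta>_0: "\<And>p. p \<ge> 1 \<Longrightarrow> \<beta> 0 p = - cnj (\<alpha> (p - 1))"
    and \<beta>_Suc: "\<And>m p. p \<ge> 1 \<Longrightarrow>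
      \<beta> (Suc m) p = \<beta> m (p - 1) + \<alpha> (p - 1) * (\<Sum>i\<le>m. \<beta> i p * \<beta> (m - i) (p - 1))"
    and j: "filterlim j at_top sequentially"
    and down: "\<And>k k'. k \<in> S \<Longrightarrow> k' \<le> k \<Longrightarrow> k' \<in> S"
  shows "(\<forall>k\<in>S. \<forall>m. convergent (\<lambda>n. \<alpha> (k + j n) * \<beta> m (k + j n))) \<longleftrightarrow>
         (\<forall>k\<in>S. \<forall>l\<ge>1. convergent (\<lambda>n. \<alpha> (k + j n) * cnj (\<alpha> (k + j n - l))))"
proof -
  define \<gamma> where "\<gamma> m l k n = \<alpha> (k + j n) * \<beta> m (k + j n - int l)" for m l k n
  have large: "\<forall>\<^sub>F n in sequentially. k + j n - int l \<ge> 1" for k l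
  proof -
    have "\<forall>\<^sub>F n in sequentially. j n \<ge> 1 + int l - k"
      using j unfolding filterlim_at_top by blast
    then show ?thesis by eventually_elim simp
  qed
  have \<gamma>_0: "\<forall>\<^sub>F n in sequentially. \<gamma> 0 l k n = - (\<alpha> (k + j n) * cnj (\<alpha> (k + j n - int (Suc l))))" for l k
    using large[of k l] by eventually_elim (simp add: \<gamma>_def \<beta>_0 algebra_simps)
  have \<gamma>_Suc: "\<forall>\<^sub>F n in sequentially. \<gamma> (Suc m) l k n = \<gamma> m (Suc l) k n +
      (\<Sum>i\<le>m. \<gamma> i l k n * \<gamma> (m - i) 0 (k - int (Suc l)) n)" for m l k
    using large[of k l]
  proof eventually_elim
    case (elim n)
    have p: "k + j n - int l - 1 = k + j n - int (Suc l)"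
      "k - int (Suc l) + j n = k + j n - int (Suc l)" by simp_all
    show ?case
      unfolding \<gamma>_def \<beta>_Suc[OF elim] p by (simp add: sum_distrib_left algebra_simps)
  qed
  have "(\<forall>k\<in>S. \<forall>m. convergent (\<gamma> m 0 k)) \<longleftrightarrow> (\<forall>k\<in>S. \<forall>l. convergent (\<gamma> 0 l k))"
  proof
    assume base: "\<forall>k\<in>S. \<forall>m. convergent (\<gamma> m 0 k)"
    have "\<forall>k\<in>S. \<forall>m. convergent (\<gamma> m l k)" for l
    proof (induction l)
      case (Suc l)
      show ?case
      proof (intro ballI allI)
        fix k m assume k: "k \<in> S"
        then have "k - int (Suc l) \<in> S" by (rule down) simp
        then have conv: "convergent (\<lambda>n. \<gamma> (Suc m) l k n -
            (\<Sum>i\<le>m. \<gamma> i l k n * \<gamma> (m - i) 0 (k - int (Suc l)) n))"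
          using Suc k base by (intro convergent_diff convergent_sum convergent_mult) auto
        have "\<forall>\<^sub>F n in sequentially. \<gamma> m (Suc l) k n = \<gamma> (Suc m) l k n -
            (\<Sum>i\<le>m. \<gamma> i l k n * \<gamma> (m - i) 0 (k - int (Suc l)) n)"
          using \<gamma>_Suc[of m l k] by eventually_elim simp
        from convergent_cong[OF this] conv show "convergent (\<gamma> m (Suc l) k)"
          by simp
      qed
    qed (use base in blast)
    then show "\<forall>k\<in>S. \<forall>l. convergent (\<gamma> 0 l k)" by blast
  next
    assume base: "\<forall>k\<in>S. \<forall>l. convergent (\<gamma> 0 l k)"
    have "\<forall>k\<in>S. \<forall>l. convergent (\<gamma> m l k)" for m
    proof (induction m rule: less_induct)
      case (less m)
      show ?case
      proof (cases m)
        case 0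
        then show ?thesis using base by simp
      next
        case (Suc m')
        show ?thesis
        proof (intro ballI allI)
          fix k l assume k: "k \<in> S"
          then have k': "k - int (Suc l) \<in> S" by (rule down) simp
          have "convergent (\<lambda>n. \<gamma> m' (Suc l) k n +
              (\<Sum>i\<le>m'. \<gamma> i l k n * \<gamma> (m' - i) 0 (k - int (Suc l)) n))"
            using less.IH k k' Suc by (intro convergent_add convergent_sum convergent_mult) auto
          then show "convergent (\<gamma> m l k)"
            using convergent_cong[OF \<gamma>_Suc[of m' l k]] Suc by simp
        qed
      qed
    qed
    then show "\<forall>k\<in>S. \<forall>m. convergent (\<gamma> m 0 k)" by blast
  qed
  moreover have "convergent (\<gamma> 0 l k) \<longleftrightarrow>
      convergent (\<lambda>n. \<alpha> (k + j n) * cnj (\<alpha> (k + j n - int (Suc l))))" for k l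
    unfolding convergent_cong[OF \<gamma>_0] by (rule convergent_minus_iff[symmetric])
  moreover have "(\<forall>l\<ge>1. P l) \<longleftrightarrow> (\<forall>l. P (int (Suc l)))" for P :: "int \<Rightarrow> bool"
  proof safe
    fix l :: int assume "\<forall>l. P (int (Suc l))" "1 \<le> l"
    then show "P l"
      using spec[of "\<lambda>l. P (int (Suc l))" "nat (l - 1)"] by simp
  qed simp
  moreover have "\<gamma> m 0 k = (\<lambda>n. \<alpha> (k + j n) * \<beta> m (k + j n))" for m k
    by (simp add: \<gamma>_def fun_eq_iff)
  ultimately show ?thesis by simp
qed

section \<open>The quotients of the orthogonal polynomials by their reversals\<close>

text \<open>For \<open>\<bar>a\<bar> < 1\<close> the map \<open>u \<mapsto> (u - cnj a) / (1 - a u)\<close> is an automorphism of the unit disc.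
  The inequality is the homogeneous form with \<open>u = w / v\<close>; it also covers \<open>\<bar>a\<bar> = 1\<close> and vanishing
  denominators.\<close>
lemma norm_blaschke_numerator_le:
  fixes a v w :: complex
  assumes "norm a \<le> 1" "norm w \<le> norm v"
  shows "norm (w - cnj a * v) \<le> norm (v - a * w)"
proof -
  \<comment> \<open>The difference of the squared norms factors.\<close>
  have "complex_of_real ((norm (v - a * w))\<^sup>2 - (norm (w - cnj a * v))\<^sup>2) =
      complex_of_real ((1 - (norm a)\<^sup>2) * ((norm v)\<^sup>2 - (norm w)\<^sup>2))"
    unfolding of_real_diff of_real_mult complex_norm_square by (simp add: algebra_simps)
  then have "(norm (v - a * w))\<^sup>2 - (norm (w - cnj a * v))\<^sup>2 =
      (1 - (norm a)\<^sup>2) * ((norm v)\<^sup>2 - (norm w)\<^sup>2)"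
    by (simp only: of_real_eq_iff)
  moreover have "\<dots> \<ge> 0"
    using assms by (intro mult_nonneg_nonneg) (auto simp: power_mono power_le_one)
  ultimately have "(norm (w - cnj a * v))\<^sup>2 \<le> (norm (v - a * w))\<^sup>2" by linarith
  then show ?thesis by (rule power2_le_imp_le) simp
qed

text \<open>The function \<open>b\<^sub>n = \<Phi>\<^sub>n / \<Phi>\<^sub>n\<^sup>*\<close>.\<close>
definition schur_ratio :: "complex measure \<Rightarrow> nat \<Rightarrow> complex \<Rightarrow> complex" where
  "schur_ratio M n z = poly (monic_OPUC M n) z / poly (OPUC_rev M (int n)) z"

context nontrivial_circle_measure
begin

lemma poly_monic_OPUC_Suc:
  "poly (monic_OPUC M (Suc n)) z =
     z * poly (monic_OPUC M n) z - cnj (verblunsky M (int n)) * poly (OPUC_rev M (int n)) z"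
  by (simp add: monic_OPUC_Suc OPUC_rev_nat)

lemma poly_OPUC_rev_Suc:
  "poly (OPUC_rev M (int n + 1)) z =
     poly (OPUC_rev M (int n)) z - verblunsky M (int n) * (z * poly (monic_OPUC M n) z)"
  by (simp add: OPUC_rev_Suc)

text \<open>On the disc \<open>\<Phi>\<^sub>n\<^sup>*\<close> has no zeros and \<open>\<bar>b\<^sub>n\<bar> \<le> 1\<close>.\<close>
lemma OPUC_rev_nonzero_dominates:
  assumes "norm z < 1"
  shows "poly (OPUC_rev M (int n)) z \<noteq> 0 \<and>
    norm (poly (monic_OPUC M n) z) \<le> norm (poly (OPUC_rev M (int n)) z)"
proof (induction n)
  case 0
  have "OPUC_rev M (int 0) = 1" "monic_OPUC M 0 = 1"
    unfolding OPUC_rev_nat by (simp_all add: monic_OPUC_eq_szego_poly reversed_poly_def)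
  then show ?case by simp
next
  case (Suc n)
  define v where "v = poly (OPUC_rev M (int n)) z"
  define w where "w = z * poly (monic_OPUC M n) z"
  define a where "a = verblunsky M (int n)"
  have a: "norm a \<le> 1"
    by (simp add: a_def norm_verblunsky_le_1)
  have v: "v \<noteq> 0"
    using Suc by (simp add: v_def)
  have "norm w \<le> norm z * norm v"
    using Suc by (simp add: v_def w_def norm_mult mult_left_mono)
  also have "\<dots> < 1 * norm v"
    using assms v by (intro mult_strict_right_mono) auto
  finally have wv: "norm w < norm v" by simp
  have "norm (a * w) \<le> 1 * norm w"
    unfolding norm_mult using a by (intro mult_right_mono) auto
  with wv have "norm (a * w) < norm v" by simp
  then have "v - a * w \<noteq> 0" by auto
  moreover have "norm (w - cnj a * v) \<le> norm (v - a * w)"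
    using a wv by (intro norm_blaschke_numerator_le) auto
  moreover have "poly (OPUC_rev M (int (Suc n))) z = v - a * w"
    using poly_OPUC_rev_Suc[of n z] by (simp add: v_def w_def a_def add.commute)
  moreover have "poly (monic_OPUC M (Suc n)) z = w - cnj a * v"
    unfolding poly_monic_OPUC_Suc by (simp add: v_def w_def a_def)
  ultimately show ?case by simp
qed

lemma norm_schur_ratio_le_1: "norm z < 1 \<Longrightarrow> norm (schur_ratio M n z) \<le> 1"
  using OPUC_rev_nonzero_dominates[of z n] by (simp add: schur_ratio_def norm_divide divide_le_eq_1)

lemma schur_ratio_holomorphic: "schur_ratio M n holomorphic_on ball 0 1"
  unfolding schur_ratio_def using OPUC_rev_nonzero_dominates
  by (intro holomorphic_intros) auto

lemma OPUC_ratio_eq: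
  assumes "norm z < 1"
  shows "OPUC_ratio M (int n) z = 1 - verblunsky M (int n) * (z * schur_ratio M n z)"
proof -
  have "poly (OPUC_rev M (int n)) z \<noteq> 0"
    using OPUC_rev_nonzero_dominates[OF assms] by simp
  then show ?thesis
    by (simp add: OPUC_ratio_def poly_OPUC_rev_Suc schur_ratio_def diff_divide_distrib)
qed

lemma schur_ratio_Suc:
  assumes "norm z < 1"
  shows "schur_ratio M (Suc n) z * (1 - verblunsky M (int n) * (z * schur_ratio M n z)) =
    z * schur_ratio M n z - cnj (verblunsky M (int n))"
proof -
  have nz: "poly (OPUC_rev M (int n)) z \<noteq> 0" "poly (OPUC_rev M (int n + 1)) z \<noteq> 0"
    using OPUC_rev_nonzero_dominates[OF assms, of n] OPUC_rev_nonzero_dominates[OF assms, of "Suc n"]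
    by (simp_all add: add.commute)
  have "schur_ratio M (Suc n) z * OPUC_ratio M (int n) z =
      poly (monic_OPUC M (Suc n)) z / poly (OPUC_rev M (int n)) z"
    using nz by (simp add: schur_ratio_def OPUC_ratio_def add.commute)
  also have "\<dots> = z * schur_ratio M n z - cnj (verblunsky M (int n))"
    using nz by (simp add: poly_monic_OPUC_Suc schur_ratio_def diff_divide_distrib)
  finally show ?thesis
    by (simp add: OPUC_ratio_eq[OF assms])
qed

lemma OPUC_ratio_neg: "n < 0 \<Longrightarrow> OPUC_ratio M n z = 1"
proof -
  have "OPUC_rev M 0 = 1"
    using OPUC_rev_nat[of 0] by (simp add: monic_OPUC_eq_szego_poly reversed_poly_def)
  then show "n < 0 \<Longrightarrow> OPUC_ratio M n z = 1"
    by (cases "n = -1") (simp_all add: OPUC_ratio_def OPUC_rev_def)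
qed

lemma OPUC_ratio_holomorphic: "OPUC_ratio M n holomorphic_on ball 0 1"
proof (cases "n \<ge> 0")
  case True
  have "(\<lambda>z. 1 - verblunsky M n * (z * schur_ratio M (nat n) z)) holomorphic_on ball 0 1"
    by (intro holomorphic_intros schur_ratio_holomorphic)
  then show ?thesis
    by (rule holomorphic_transform) (use OPUC_ratio_eq[of _ "nat n"] True in simp)
next
  case False
  then have "OPUC_ratio M n = (\<lambda>z. 1)"
    by (simp add: fun_eq_iff OPUC_ratio_neg)
  then show ?thesis by simp
qed

lemma norm_OPUC_ratio_le_2:
  assumes "norm z < 1"
  shows "norm (OPUC_ratio M n z) \<le> 2"
proof (cases "n \<ge> 0")
  case True
  have "norm (verblunsky M n * (z * schur_ratio M (nat n) z)) \<le> 1 * (1 * 1)"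
    unfolding norm_mult using assms
    by (intro mult_mono norm_verblunsky_le_1 norm_schur_ratio_le_1) auto
  then have "norm (1 - verblunsky M n * (z * schur_ratio M (nat n) z)) \<le> 1 + 1"
    by (intro order_trans[OF norm_triangle_ineq4] add_mono) auto
  then show ?thesis
    using OPUC_ratio_eq[OF assms, of "nat n"] True by simp
qed (simp add: OPUC_ratio_neg)

text \<open>The Taylor series of \<open>b\<^sub>n\<close> at 0.\<close>
definition schur_fps :: "nat \<Rightarrow> complex fps" where
  "schur_fps n = fps_expansion (schur_ratio M n) 0"

lemma schur_ratio_has_fps_expansion: "schur_ratio M n has_fps_expansion schur_fps n"
  unfolding schur_fps_def
  by (rule has_fps_expansion_fps_expansion[of "ball 0 1"]) (simp_all add: schur_ratio_holomorphic)

lemma shifted_schur_has_fps_expansion: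
  "(\<lambda>z. z * schur_ratio M n z) has_fps_expansion fps_X * schur_fps n"
  by (rule has_fps_expansion_mult[OF has_fps_expansion_fps_X schur_ratio_has_fps_expansion])

lemma ratio_has_fps_expansion:
  "(\<lambda>z. 1 - verblunsky M (int n) * (z * schur_ratio M n z)) has_fps_expansion
    1 - fps_const (verblunsky M (int n)) * (fps_X * schur_fps n)"
  by (rule has_fps_expansion_diff[OF has_fps_expansion_1
        has_fps_expansion_cmult_left[OF shifted_schur_has_fps_expansion]])

lemma schur_fps_Suc:
  "schur_fps (Suc n) * (1 - fps_const (verblunsky M (int n)) * (fps_X * schur_fps n)) =
    fps_X * schur_fps n - fps_const (cnj (verblunsky M (int n)))"
  by (rule fps_eq_if_eq_on_disc[OF _ _ schur_ratio_Suc[of _ n]])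
     (rule has_fps_expansion_mult[OF schur_ratio_has_fps_expansion ratio_has_fps_expansion]
       has_fps_expansion_diff[OF shifted_schur_has_fps_expansion has_fps_expansion_const])+

lemma OPUC_ratio_fps:
  "fps_expansion (OPUC_ratio M (int n)) 0 =
    1 - fps_const (verblunsky M (int n)) * (fps_X * schur_fps n)"
proof (rule fps_eq_if_eq_on_disc[OF _ _ OPUC_ratio_eq[of _ n]])
  show "OPUC_ratio M (int n) has_fps_expansion fps_expansion (OPUC_ratio M (int n)) 0"
    by (rule has_fps_expansion_fps_expansion[of "ball 0 1"]) (simp_all add: OPUC_ratio_holomorphic)
qed (rule ratio_has_fps_expansion)

lemma schur_fps_nth_0: "fps_nth (schur_fps (Suc n)) 0 = - cnj (verblunsky M (int n))"
  using arg_cong[OF schur_fps_Suc[of n], of "\<lambda>F. fps_nth F 0"] by simp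

lemma schur_fps_nth_Suc:
  "fps_nth (schur_fps (Suc n)) (Suc m) = fps_nth (schur_fps n) m +
    verblunsky M (int n) * (\<Sum>i\<le>m. fps_nth (schur_fps (Suc n)) i * fps_nth (schur_fps n) (m - i))"
proof -
  have "schur_fps (Suc n) = fps_X * schur_fps n - fps_const (cnj (verblunsky M (int n))) +
      fps_const (verblunsky M (int n)) * (fps_X * (schur_fps (Suc n) * schur_fps n))"
    using schur_fps_Suc[of n] by (simp add: algebra_simps)
  from arg_cong[OF this, of "\<lambda>F. fps_nth F (Suc m)"]
  have "fps_nth (schur_fps (Suc n)) (Suc m) = fps_nth (schur_fps n) m +
      verblunsky M (int n) * fps_nth (schur_fps (Suc n) * schur_fps n) m"
    by simp
  also have "fps_nth (schur_fps (Suc n) * schur_fps n) m =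
      (\<Sum>i\<le>m. fps_nth (schur_fps (Suc n)) i * fps_nth (schur_fps n) (m - i))"
    by (simp add: fps_mult_nth atLeast0AtMost)
  finally show ?thesis .
qed

text \<open>The constant coefficient of \<open>\<Omega>\<^sub>n\<close> is 1 and that of \<open>z\<^sup>m\<^sup>+\<^sup>1\<close> is \<open>- \<alpha>\<^sub>n [z\<^sup>m] b\<^sub>n\<close>.\<close>
lemma OPUC_ratio_converges_iff:
  fixes j :: "nat \<Rightarrow> int"
  assumes j: "filterlim j at_top sequentially"
  shows "(\<exists>g. \<forall>K. compact K \<and> K \<subseteq> ball 0 1 \<longrightarrow> uniform_limit K (\<lambda>n. OPUC_ratio M (j n)) g sequentially) \<longleftrightarrow>
    (\<forall>m. convergent (\<lambda>n. verblunsky M (j n) * fps_nth (schur_fps (nat (j n))) m))"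
proof -
  let ?c = "\<lambda>m n. fps_nth (fps_expansion (OPUC_ratio M (j n)) 0) m"
  have nonneg: "\<forall>\<^sub>F n in sequentially. j n \<ge> 0"
    using j unfolding filterlim_at_top by blast
  have "\<forall>\<^sub>F n in sequentially. ?c 0 n = 1"
    using nonneg
  proof eventually_elim
    case (elim n)
    then show ?case using OPUC_ratio_fps[of "nat (j n)"] by simp
  qed
  from convergent_cong[OF this] have zero: "convergent (?c 0)"
    by (simp add: convergent_const)
  have coeff_Suc: "\<forall>\<^sub>F n in sequentially. ?c (Suc m) n =
      - (verblunsky M (j n) * fps_nth (schur_fps (nat (j n))) m)" for m
    using nonneg
  proof eventually_elim
    case (elim n)
    then show ?case using OPUC_ratio_fps[of "nat (j n)"] by simp
  qed
  have Suc: "convergent (?c (Suc m)) \<longleftrightarrow>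
      convergent (\<lambda>n. verblunsky M (j n) * fps_nth (schur_fps (nat (j n))) m)" for m
    unfolding convergent_cong[OF coeff_Suc] by (rule convergent_minus_iff[symmetric])
  have "(\<forall>m. convergent (?c m)) \<longleftrightarrow> (\<forall>m. convergent (?c (Suc m)))"
  proof
    assume *: "\<forall>m. convergent (?c (Suc m))"
    show "\<forall>m. convergent (?c m)"
    proof
      fix m
      show "convergent (?c m)"
        using zero * by (cases m) simp_all
    qed
  qed simp
  then show ?thesis
    using locally_uniform_limit_iff_taylor_coeffs[of "\<lambda>n. OPUC_ratio M (j n)" 2]
    by (simp add: OPUC_ratio_holomorphic norm_OPUC_ratio_le_2 Suc)
qed

text \<open>A limit, if it exists, automatically lies in the closed disc.\<close>
lemma verblunsky_product_convergent_iff: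
  fixes p q :: "nat \<Rightarrow> int"
  shows "(\<exists>c\<in>cball 0 1. (\<lambda>n. verblunsky M (p n) * cnj (verblunsky M (q n))) \<longlonglongrightarrow> c) \<longleftrightarrow>
    convergent (\<lambda>n. verblunsky M (p n) * cnj (verblunsky M (q n)))"
proof
  assume "convergent (\<lambda>n. verblunsky M (p n) * cnj (verblunsky M (q n)))"
  then obtain c where c: "(\<lambda>n. verblunsky M (p n) * cnj (verblunsky M (q n))) \<longlonglongrightarrow> c"
    by (auto simp: convergent_def)
  have "norm (verblunsky M (p n) * cnj (verblunsky M (q n))) \<le> 1 * 1" for n
    unfolding norm_mult complex_mod_cnj by (intro mult_mono norm_verblunsky_le_1) auto
  then have "norm c \<le> 1"
    by (intro Lim_norm_ubound[OF _ c]) auto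
  with c show "\<exists>c\<in>cball 0 1. (\<lambda>n. verblunsky M (p n) * cnj (verblunsky M (q n))) \<longlonglongrightarrow> c"
    by auto
qed (auto simp: convergent_def)

end

theorem theorem4p2:
  fixes M :: "complex measure" and j :: "nat \<Rightarrow> int" and k' :: "int extended"
  assumes "nontrivial_circle_prob M"
    and "strict_mono j"
    and "k' \<noteq> Minf"
  shows "(\<forall>k::int. Fin k < k' \<longrightarrow>
            (\<exists>g. \<forall>K. compact K \<and> K \<subseteq> ball 0 1 \<longrightarrow>
               uniform_limit K (\<lambda>n. OPUC_ratio M (k + j n)) g sequentially)) \<longleftrightarrow>
         (\<forall>l::int. \<forall>k::int. l \<ge> 1 \<and> Fin k < k' \<longrightarrow>
            (\<exists>c\<in>cball 0 1.
               (\<lambda>n. verblunsky M (k + j n) * cnj (verblunsky M (k + j n - l)))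
                 \<longlonglongrightarrow> c))"
proof -
  interpret nontrivial_circle_measure M
    by unfold_locales (rule assms(1))
  have ge: "j n \<ge> j 0 + int n" for n
  proof (induction n)
    case (Suc n)
    have "j n < j (Suc n)"
      using assms(2) by (simp add: strict_mono_less)
    with Suc show ?case by simp
  qed simp
  have lim: "filterlim (\<lambda>n. k + j n) at_top sequentially" for k
    unfolding filterlim_at_top eventually_sequentially
  proof (intro allI exI impI)
    fix Z n assume "nat (Z - k - j 0) \<le> n"
    then show "Z \<le> k + j n" using ge[of n] by linarith
  qed
  from lim[of 0] have lim_j: "filterlim j at_top sequentially" by simp
  define S where "S = {k. Fin k < k'}"
  have down: "k2 \<in> S" if "k1 \<in> S" "k2 \<le> k1" for k1 k2
    using that le_less_trans[of "Fin k2" "Fin k1" k'] by (simp add: S_def)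
  have "(\<forall>k\<in>S. \<forall>m. convergent (\<lambda>n. verblunsky M (k + j n) * fps_nth (schur_fps (nat (k + j n))) m)) \<longleftrightarrow>
    (\<forall>k\<in>S. \<forall>l\<ge>1. convergent (\<lambda>n. verblunsky M (k + j n) * cnj (verblunsky M (k + j n - l))))"
  proof (rule convergent_schur_coeffs_iff[where \<beta> = "\<lambda>m p. fps_nth (schur_fps (nat p)) m", OF _ _ lim_j down])
    fix p :: int assume p: "p \<ge> 1"
    then obtain n where n: "p = int n + 1"
      by (metis add.commute zle_iff_zadd)
    then have nat: "nat p = Suc n" "nat (p - 1) = n" "p - 1 = int n" by simp_all
    show "fps_nth (schur_fps (nat p)) 0 = - cnj (verblunsky M (p - 1))"
      unfolding nat by (rule schur_fps_nth_0)
    show "fps_nth (schur_fps (nat p)) (Suc m) = fps_nth (schur_fps (nat (p - 1))) m +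
        verblunsky M (p - 1) * (\<Sum>i\<le>m. fps_nth (schur_fps (nat p)) i * fps_nth (schur_fps (nat (p - 1))) (m - i))" for m
      unfolding nat nat_int by (rule schur_fps_nth_Suc)
  qed
  then show ?thesis
    unfolding OPUC_ratio_converges_iff[OF lim] verblunsky_product_convergent_iff S_def mem_Collect_eq
    by blast
qed

end
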